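(* Let $\delta\in(0,1)$, let $d\ge 1$, and set $k=\lceil 360\log(2/\delta)\rceil$. Let $N\ge 1$ be an integer divisible by $k$, and let $X_1,\ldots,X_N$ be i.i.d. random vectors in $\mathbb{R}^d$ with mean $\mu\in\mathbb{R}^d$ and (finite) covariance matrix $\Sigma$. Let $\widehat{\mu}_N$ be the mean estimator with parameter $k$ defined in the context, i.e. $\widehat{\mu}_N\in\operatorname{argmin}_{a\in\mathbb{R}^d}\operatorname{diam}(S_a^c)$, where any minimizer may be picked if there are several. Then, with probability at least $1-\delta$, $$\left\|\widehat{\mu}_N-\mu\right\|\le 2\max\left(400\sqrt{\frac{\operatorname{Tr}(\Sigma)}{N}},\;240\sqrt{\frac{\lambda_{\max}\log(2/\delta)}{N}}\right).$$
   Context: $\|\cdot\|$ is the Euclidean norm on $\mathbb{R}^d$. $\Sigma=\mathbb{E}(X-\mu)(X-\mu)^T$ is the common covariance matrix (assumed to exist), where $X$ has the common distribution of the $X_i$; $\operatorname{Tr}(\Sigma)$ is its trace and $\lambda_{\max}$ is its largest eigenvalue. $\log$ is the natural logarithm, and $[k]=\{1,\ldots,k\}$. The estimator. The index set $\{1,\ldots,N\}$ is partitioned (in a fixed way, not depending on the data) into $k$ disjoint blocks $B_1,\ldots,B_k$, each of size $m=N/k$. The block means are $Z_j=\frac1m\sum_{i\in B_j}X_i$ for $j\in[k]$. For $a\in\mathbb{R}^d$ let $$S_a=\left\{x\in\mathbb{R}^d:\ \exists J\subset[k]\text{ with }|J|>k/2\text{ such that }\min_{j\in J}\left(\|Z_j-x\|-\|Z_j-a\|\right)>0\right\},$$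 i.e. $S_a$ is the set of points $x$ for which $\|Z_j-x\|>\|Z_j-a\|$ for more than $k/2$ of the indices $j$. $S_a^c=\mathbb{R}^d\setminus S_a$ is its complement and $\operatorname{diam}$ denotes the Euclidean diameter. The minimum of $a\mapsto\operatorname{diam}(S_a^c)$ over $\mathbb{R}^d$ is always attained, and $\widehat{\mu}_N$ is any minimizer. *)

theory Defs
  imports "HOL-Probability.Probability"
begin

definition mean :: "(real ^ 'd) measure \<Rightarrow> real ^ 'd" where
  "mean D = (\<integral>x. x \<partial>D)"

definition has_covariance :: "(real ^ 'd) measure \<Rightarrow> bool" where
  "has_covariance D \<longleftrightarrow>
     integrable D (\<lambda>x. x) \<and>
     (\<forall>p q. integrable D (\<lambda>x. (x - mean D) $ p * (x - mean D) $ q))"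

definition covariance_matrix :: "(real ^ 'd) measure \<Rightarrow> real ^ 'd ^ 'd" where
  "covariance_matrix D = (\<chi> p q. \<integral>x. (x - mean D) $ p * (x - mean D) $ q \<partial>D)"

(* For a real symmetric matrix the set below is finite and nonempty, so Max is meaningful. *)
definition max_eigenvalue :: "real ^ 'd ^ 'd \<Rightarrow> real" where
  "max_eigenvalue A = Max {c. \<exists>v. v \<noteq> 0 \<and> A *v v = c *\<^sub>R v}"

definition equal_blocks :: "nat \<Rightarrow> nat \<Rightarrow> (nat \<Rightarrow> nat set) \<Rightarrow> bool" where
  "equal_blocks N k B \<longleftrightarrow>
     disjoint_family_on B {1..k} \<and> (\<Union>j\<in>{1..k}. B j) = {1..N} \<and>
     (\<forall>j\<in>{1..k}. card (B j) = N div k)"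

definition block_mean :: "nat \<Rightarrow> nat \<Rightarrow> (nat \<Rightarrow> nat set) \<Rightarrow> (nat \<Rightarrow> real ^ 'd) \<Rightarrow> nat \<Rightarrow> real ^ 'd" where
  "block_mean N k B x j = (1 / real (N div k)) *\<^sub>R (\<Sum>i\<in>B j. x i)"

definition S_set :: "nat \<Rightarrow> (nat \<Rightarrow> real ^ 'd) \<Rightarrow> real ^ 'd \<Rightarrow> (real ^ 'd) set" where
  "S_set k Z a =
     {x. \<exists>J\<subseteq>{1..k}. real (card J) > real k / 2 \<and>
           (MIN j\<in>J. norm (Z j - x) - norm (Z j - a)) > 0}"

(* The minimizer need not be unique, hence a predicate. *)
definition is_mean_estimate :: "nat \<Rightarrow> (nat \<Rightarrow> real ^ 'd) \<Rightarrow> real ^ 'd \<Rightarrow> bool" where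
  "is_mean_estimate k Z a \<longleftrightarrow> is_arg_min (\<lambda>a. diameter (- S_set k Z a)) (\<lambda>_. True) a"

(* A choice of minimizers, one for each outcome, need not be measurable, so the event is
   required to contain a measurable set of probability at least p; for a measurable event
   this says exactly that its probability is at least p. *)
definition with_prob_at_least :: "'a measure \<Rightarrow> real \<Rightarrow> ('a \<Rightarrow> bool) \<Rightarrow> bool" where
  "with_prob_at_least M p P \<longleftrightarrow> (\<exists>E\<in>sets M. measure M E \<ge> p \<and> (\<forall>\<omega>\<in>E. P \<omega>))"

lemma with_prob_at_least_measurable:
  assumes "prob_space M" and "{\<omega> \<in> space M. P \<omega>} \<in> sets M"
  shows "with_prob_at_least M p P \<longleftrightarrow> measure M {\<omega> \<in> space M. P \<omega>} \<ge> p"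
proof
  interpret prob_space M by fact
  assume "with_prob_at_least M p P"
  then obtain E where E: "E \<in> sets M" "measure M E \<ge> p" "\<forall>\<omega>\<in>E. P \<omega>"
    unfolding with_prob_at_least_def by blast
  have "E \<subseteq> {\<omega> \<in> space M. P \<omega>}"
    using E sets.sets_into_space by blast
  then have "measure M E \<le> measure M {\<omega> \<in> space M. P \<omega>}"
    using assms(2) by (rule finite_measure_mono)
  with E(2) show "measure M {\<omega> \<in> space M. P \<omega>} \<ge> p" by linarith
next
  assume "measure M {\<omega> \<in> space M. P \<omega>} \<ge> p"
  then show "with_prob_at_least M p P"
    using assms(2) unfolding with_prob_at_least_def by blast
qed

end

theory Submission imports Defs begin

text \<open>
  Let \<open>\<rho>\<close> be half the claimed bound and \<open>Y\<^sub>j = Z\<^sub>j - \<mu>\<close>. If every half-space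
  \<open>{y. v \<bullet> y > \<rho>/2}\<close> with \<open>v\<close> a unit vector contains fewer than half of the \<open>Y\<^sub>j\<close>, then the
  complement of \<open>S\<^sub>\<mu>\<close> lies in the ball of radius \<open>\<rho>\<close> about \<open>\<mu>\<close>. For a minimizer \<open>a\<close>, either
  \<open>a\<close> lies in this complement, or \<open>\<mu>\<close> lies in the complement of \<open>S\<^sub>a\<close>, whose diameter is at most
  \<open>2\<rho>\<close> by minimality.

  The uniform bound over half-spaces is a PAC-Bayes argument. Replace the direction \<open>v\<close> by the
  Gaussian vector \<open>\<theta> = \<surd>\<beta> v + g\<close> with \<open>g\<close> standard normal and \<open>\<beta> = k/10\<close>. By symmetry of \<open>g\<close>, a
  point in the half-space of \<open>v\<close> is in the random half-space \<open>\<theta> \<bullet> y > \<surd>\<beta> \<rho>/2\<close> with probability at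
  least \<open>1/2\<close>. The Cameron-Martin formula and Jensen's inequality bound the sum of these probabilities,
  simultaneously for all \<open>v\<close>, by a single exponential moment under \<open>g\<close> at the cost \<open>\<beta>/2\<close>, and
  this moment is controlled by Markov's inequality. Chebyshev's inequality bounds the mean of
  the random half-space under \<open>Y\<^sub>j\<close>, the noise \<open>g\<close> contributing the trace of \<open>\<Sigma>\<close>.
\<close>

section \<open>The largest eigenvalue of a symmetric matrix\<close>

lemma symmetric_matrix_inner:
  fixes A :: "real ^ 'n ^ 'n"
  assumes "transpose A = A"
  shows "(A *v x) \<bullet> y = x \<bullet> (A *v y)"
  using assms by (metis dot_lmul_matrix vector_transpose_matrix)

text \<open>Eigenvectors for distinct eigenvalues are orthogonal, hence independent, so the
  dimension bounds their number. Finiteness is what allows \<open>Max_ge\<close> to be applied to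
  \<open>max_eigenvalue\<close>.\<close>

lemma finite_eigenvalues_symmetric:
  fixes A :: "real ^ 'n ^ 'n"
  assumes sym: "transpose A = A"
  shows "finite {c. \<exists>v. v \<noteq> 0 \<and> A *v v = c *\<^sub>R v}" (is "finite ?E")
proof -
  have "\<forall>c\<in>?E. \<exists>v. v \<noteq> 0 \<and> A *v v = c *\<^sub>R v" by simp
  from bchoice[OF this] obtain e where e: "\<forall>c\<in>?E. e c \<noteq> 0 \<and> A *v e c = c *\<^sub>R e c" ..
  define S where "S = ?E"
  have e0: "e c \<noteq> 0" and eA: "A *v e c = c *\<^sub>R e c" if "c \<in> S" for c
    using e that unfolding S_def by (metis (no_types, lifting))+
  have orth: "e c \<bullet> e c' = 0" if "c \<in> S" "c' \<in> S" "c \<noteq> c'" for c c'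
  proof -
    have "c * (e c \<bullet> e c') = c' * (e c \<bullet> e c')"
      using symmetric_matrix_inner[OF sym, of "e c" "e c'"] eA[OF that(1)] eA[OF that(2)] by simp
    then show ?thesis using that(3) by simp
  qed
  have inj: "inj_on e S"
    by (rule inj_onI, rule ccontr) (metis orth e0 inner_eq_zero_iff)
  have "pairwise orthogonal (e ` S)"
    by (auto simp: pairwise_def orthogonal_def intro!: orth)
  moreover have "0 \<notin> e ` S" using e0 by (metis imageE)
  ultimately have "independent (e ` S)"
    by (rule pairwise_orthogonal_independent)
  then have "finite (e ` S)" by (rule finiteI_independent)
  then show ?thesis using finite_imageD[OF _ inj] unfolding S_def by blast
qed

text \<open>A maximizer of the quadratic form on the unit sphere is an eigenvector, because the
  nonnegative form \<open>v \<mapsto> c \<parallel>v\<parallel>\<^sup>2 - v \<bullet> A v\<close> vanishes there to first order.\<close>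
lemma quadratic_form_le_max_eigenvalue:
  fixes A :: "real ^ 'n ^ 'n"
  assumes sym: "transpose A = A"
  shows "v \<bullet> (A *v v) \<le> max_eigenvalue A * (norm v)\<^sup>2"
proof -
  define Q where "Q v = v \<bullet> (A *v v)" for v
  have "sphere 0 1 \<noteq> ({} :: (real^'n) set)" by simp
  moreover have "continuous_on (sphere 0 1) Q"
    unfolding Q_def by (intro continuous_intros linear_continuous_on matrix_vector_mul_bounded_linear)
  ultimately obtain w where w: "norm w = 1" and max: "\<And>u. norm u = 1 \<Longrightarrow> Q u \<le> Q w"
    using continuous_attains_sup[OF compact_sphere] by (metis dist_0_norm mem_sphere)
  have Qle: "Q u \<le> Q w * (norm u)\<^sup>2" for u
  proof (cases "u = 0")
    case False
    have "Q u = (norm u)\<^sup>2 * Q (u /\<^sub>R norm u)"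
      using False unfolding Q_def
      by (simp add: linear_cmul[OF matrix_vector_mul_linear] power2_eq_square field_simps)
    also have "\<dots> \<le> (norm u)\<^sup>2 * Q w"
      using False by (intro mult_left_mono max) auto
    finally show ?thesis by (simp add: mult.commute)
  qed (simp add: Q_def)
  define z where "z = Q w *\<^sub>R w - A *v w"
  \<comment> \<open>Evaluate the form \<open>Q w * (norm u)\<^sup>2 - Q u\<close> at
    \<open>u = w + t *\<^sub>R z\<close>. The constant term cancels because
    \<open>norm w = 1\<close>, and \<open>z\<close> is chosen so that the linear coefficient is
    \<open>2 * (z \<bullet> z)\<close>.\<close>
  have quad: "0 \<le> 2 * t * (z \<bullet> z) + t\<^sup>2 * (Q w * (z \<bullet> z) - Q z)" for t
  proof -
    have z: "z \<bullet> z = Q w * (z \<bullet> w) - z \<bullet> (A *v w)"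
      by (subst (2) z_def) (simp add: inner_simps)
    have "Q (w + t *\<^sub>R z) = Q w + 2 * t * (z \<bullet> (A *v w)) + t\<^sup>2 * Q z"
      using symmetric_matrix_inner[OF sym, of w z]
      by (simp add: Q_def matrix_vector_right_distrib linear_cmul[OF matrix_vector_mul_linear] inner_add
          power2_eq_square distrib_left inner_commute)
    moreover have "(norm (w + t *\<^sub>R z))\<^sup>2 = 1 + 2 * t * (z \<bullet> w) + t\<^sup>2 * (z \<bullet> z)"
      using w by (simp only: power2_norm_eq_inner norm_eq_1)
        (simp add: inner_add power2_eq_square inner_commute)
    ultimately have "0 \<le> Q w * (1 + 2 * t * (z \<bullet> w) + t\<^sup>2 * (z \<bullet> z)) - (Q w + 2 * t * (z \<bullet> (A *v w)) + t\<^sup>2 * Q z)"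
      using Qle[of "w + t *\<^sub>R z"] by simp
    also have "\<dots> = 2 * t * (Q w * (z \<bullet> w) - z \<bullet> (A *v w)) + t\<^sup>2 * (Q w * (z \<bullet> z) - Q z)"
      by (simp add: algebra_simps)
    finally show ?thesis unfolding z[symmetric] .
  qed
  have "z \<bullet> z = 0"
  proof (rule ccontr)
    assume "z \<bullet> z \<noteq> 0"
    then have zz: "z \<bullet> z > 0" by (simp add: order_less_le)
    \<comment> \<open>\<open>K\<close> is a positive bound on the quadratic coefficient, and
      \<open>t\<close> minimizes \<open>2 * t * (z \<bullet> z) + t\<^sup>2 * K\<close>, whose
      minimum is negative.\<close>
    define K where "K = \<bar>Q w * (z \<bullet> z) - Q z\<bar> + 1"
    define t where "t = - (z \<bullet> z) / K"
    have K: "K > 0" "Q w * (z \<bullet> z) - Q z \<le> K" by (auto simp: K_def)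
    have "0 \<le> 2 * t * (z \<bullet> z) + t\<^sup>2 * K"
      using quad[of t] mult_left_mono[OF K(2), of "t\<^sup>2"] by auto
    also have "\<dots> = - (z \<bullet> z)\<^sup>2 / K"
      using K(1) by (simp add: t_def field_simps power2_eq_square)
    also have "\<dots> < 0" using zz K(1) by simp
    finally show False by simp
  qed
  then have "A *v w = Q w *\<^sub>R w" by (simp add: z_def)
  moreover have "w \<noteq> 0" using w by auto
  ultimately have "Q w \<le> max_eigenvalue A"
    unfolding max_eigenvalue_def by (intro Max_ge[OF finite_eigenvalues_symmetric[OF sym]]) blast
  then show ?thesis
    using Qle[of v] mult_right_mono[of "Q w" "max_eigenvalue A" "(norm v)\<^sup>2"] by (simp add: Q_def)
qed

section \<open>The standard Gaussian measure\<close>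

text \<open>A density with respect to \<open>lborel\<close> rather than a product measure: the
  invariance of \<open>lborel\<close> under translation and reflection then gives the shift formula
  and the symmetry directly.\<close>

definition gaussian :: "'a::euclidean_space measure" where
  "gaussian = density lborel (\<lambda>x. ennreal ((1 / sqrt (2 * pi)) ^ DIM('a) * exp (- (norm x)\<^sup>2 / 2)))"

lemma sets_gaussian [simp, measurable_cong]: "sets gaussian = sets borel"
  and space_gaussian [simp]: "space gaussian = UNIV"
  by (simp_all add: gaussian_def)

text \<open>The density factors over \<open>Basis\<close> into one-dimensional normal densities,
  each of mass 1.\<close>

lemma prob_space_gaussian: "prob_space (gaussian :: 'a::euclidean_space measure)"
proof
  have eq: "(1 / sqrt (2 * pi)) ^ DIM('a) * exp (- (norm x)\<^sup>2 / 2) = (\<Prod>b\<in>Basis. std_normal_density (x \<bullet> b))"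
    for x :: 'a
  proof -
    have "- (norm x)\<^sup>2 / 2 = (\<Sum>b\<in>Basis. - (x \<bullet> b)\<^sup>2 / 2)"
      unfolding power2_norm_eq_inner euclidean_inner[of x x]
      by (simp add: power2_eq_square sum_negf sum_divide_distrib)
    then show ?thesis
      by (simp add: std_normal_density_def prod.distrib prod_dividef exp_sum power_divide)
  qed
  have "emeasure (gaussian :: 'a measure) UNIV = (\<integral>\<^sup>+x. (\<Prod>b\<in>Basis. ennreal (std_normal_density (x \<bullet> b))) \<partial>(lborel :: 'a measure))"
    unfolding gaussian_def eq by (simp add: emeasure_density prod_ennreal del: prod_eq_1_iff)
  also have "\<dots> = 1"
    by (subst nn_integral_lborel_prod) (simp_all add: nn_integral_eq_integral)
  finally show "emeasure (gaussian :: 'a measure) (space gaussian) = 1" by simp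
qed

lemma lborel_distr_translate: "distr lborel borel (\<lambda>x::'a::euclidean_space. t + x) = lborel"
  using lborel_affine[of 1 t] by (simp add: density_1)

lemma lborel_distr_neg: "distr lborel borel (\<lambda>x::'a::euclidean_space. - x) = lborel"
  by (rule sym) (use lborel_affine[of "-1" "0::'a"] in \<open>simp add: density_1\<close>)

lemma gaussian_symmetric:
  assumes [measurable]: "F \<in> borel_measurable borel"
  shows "(\<integral>\<^sup>+x. F (- x) \<partial>gaussian) = (\<integral>\<^sup>+x. F x \<partial>gaussian)"
  unfolding gaussian_def
  by (subst (2) lborel_distr_neg[symmetric]) (simp add: nn_integral_density nn_integral_distr)

text \<open>The Cameron-Martin formula: translate \<open>lborel\<close> by \<open>w\<close> and
  expand \<open>(norm (w + x))\<^sup>2\<close>; the terms containing \<open>w\<close> become the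
  exponential weight.\<close>

lemma gaussian_shift:
  assumes [measurable]: "F \<in> borel_measurable borel"
  shows "(\<integral>\<^sup>+x. F x \<partial>gaussian)
    = (\<integral>\<^sup>+x. F (w + x) * ennreal (exp (- (w \<bullet> x) - (norm w)\<^sup>2 / 2)) \<partial>gaussian)"
proof -
  have "exp (- (norm (w + x))\<^sup>2 / 2) = exp (- (norm x)\<^sup>2 / 2) * exp (- (w \<bullet> x) - (norm w)\<^sup>2 / 2)" for x
    unfolding exp_add[symmetric] power2_norm_eq_inner
    by (simp add: inner_simps inner_commute field_simps)
  then show ?thesis
    unfolding gaussian_def
    by (subst lborel_distr_translate[of w, symmetric])
      (simp add: nn_integral_density nn_integral_distr ennreal_mult' ac_simps)
qed

lemma gaussian_mgf: "(\<integral>\<^sup>+x. ennreal (exp (w \<bullet> x)) \<partial>gaussian) = ennreal (exp ((norm w)\<^sup>2 / 2))"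
proof -
  interpret prob_space "gaussian :: 'a measure" by (rule prob_space_gaussian)
  \<comment> \<open>After a shift by \<open>w\<close> itself the weight cancels the dependence on
    \<open>x\<close>, leaving the constant \<open>exp ((norm w)\<^sup>2 / 2)\<close>.\<close>
  show ?thesis
    by (subst gaussian_shift[where w = w])
      (simp_all add: ennreal_mult'[symmetric] exp_add[symmetric] inner_simps power2_norm_eq_inner emeasure_space_1[simplified])
qed

lemma gaussian_integrable_exp: "integrable gaussian (\<lambda>x. exp (w \<bullet> x))"
  by (intro integrableI_bounded) (simp_all add: gaussian_mgf)

lemma gaussian_integrable_inner: "integrable gaussian (\<lambda>x. w \<bullet> x)"
proof (rule Bochner_Integration.integrable_bound)
  show "integrable gaussian (\<lambda>x. exp (w \<bullet> x) + exp (- w \<bullet> x))"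
    by (intro Bochner_Integration.integrable_add gaussian_integrable_exp)
  have "\<bar>t\<bar> \<le> exp t + exp (- t)" for t :: real
    using exp_ge_add_one_self[of t] exp_ge_add_one_self[of "-t"] exp_gt_zero[of t] exp_gt_zero[of "-t"]
    by (cases "t \<ge> 0") linarith+
  then show "AE x in gaussian. norm (w \<bullet> x) \<le> norm (exp (w \<bullet> x) + exp (- w \<bullet> x))"
    by (intro AE_I2) (simp add: order_trans[OF _ abs_ge_self])
qed simp

lemma gaussian_integral_symmetric:
  fixes F :: "'a::euclidean_space \<Rightarrow> real"
  assumes [measurable]: "F \<in> borel_measurable borel"
  shows "(\<integral>x. F (- x) \<partial>gaussian) = (\<integral>x. F x \<partial>gaussian)"
  unfolding gaussian_def
  by (subst (2) lborel_distr_neg[symmetric]) (simp add: integral_density integral_distr)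

lemma gaussian_mean: "(\<integral>x. w \<bullet> x \<partial>gaussian) = 0"
  using gaussian_integral_symmetric[of "\<lambda>x. w \<bullet> x"] by simp

text \<open>The closed half-spaces of \<open>y\<close> and \<open>- y\<close> have equal mass by
  symmetry and together cover the space.\<close>

lemma gaussian_half_space: "measure gaussian {x. y \<bullet> x \<ge> 0} \<ge> 1 / 2"
proof -
  interpret prob_space "gaussian :: 'a measure" by (rule prob_space_gaussian)
  have "emeasure gaussian {x. y \<bullet> x \<le> 0} = emeasure gaussian {x. y \<bullet> x \<ge> 0}"
    using gaussian_symmetric[of "indicator {x. y \<bullet> x \<ge> 0}"]
    by (simp add: indicator_def[abs_def] flip: nn_integral_indicator)
  then have "prob {x. y \<bullet> x \<le> 0} = prob {x. y \<bullet> x \<ge> 0}" by (simp add: measure_def)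
  moreover have "prob ({x. y \<bullet> x \<le> 0} \<union> {x. y \<bullet> x \<ge> 0}) \<le> prob {x. y \<bullet> x \<le> 0} + prob {x. y \<bullet> x \<ge> 0}"
    by (rule measure_subadditive) (auto simp: emeasure_eq_measure)
  moreover have "{x. y \<bullet> x \<le> 0} \<union> {x. y \<bullet> x \<ge> 0} = space gaussian" by auto
  ultimately show ?thesis using prob_space by simp
qed

text \<open>The exact value is \<open>(norm y)\<^sup>2\<close>. The cruder factor 8 needs only the
  moment generating function: for a unit vector,
  \<open>t\<^sup>2 \<le> 2 * (exp t + exp (- t))\<close> gives the bound
  \<open>4 * exp (1/2) \<le> 8\<close>.\<close>

lemma gaussian_second_moment:
  "(\<integral>\<^sup>+x. ennreal ((y \<bullet> x)\<^sup>2) \<partial>gaussian) \<le> ennreal (8 * (norm y)\<^sup>2)"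
proof (cases "y = 0")
  case False
  define u where "u = y /\<^sub>R norm y"
  have u: "norm u = 1" using False by (simp add: u_def)
  have sq: "t\<^sup>2 \<le> 2 * (exp t + exp (- t))" for t :: real
  proof -
    have "s\<^sup>2 \<le> 2 * (exp s + exp (- s))" if "s \<ge> 0" for s :: real
      using exp_lower_Taylor_quadratic[OF that] exp_ge_add_one_self[of "-s"] by argo
    from this[of t] this[of "-t"] show ?thesis by (cases "t \<ge> 0") auto
  qed
  have "exp (1/2) ^ 2 \<le> (2::real) ^ 2"
    using exp_le by (simp add: power2_eq_square flip: exp_add)
  then have "exp (1/2) \<le> (2::real)" by (rule power2_le_imp_le) simp
  have "(\<integral>\<^sup>+x. ennreal ((y \<bullet> x)\<^sup>2) \<partial>gaussian) = (\<integral>\<^sup>+x. ennreal ((norm y)\<^sup>2) * ennreal ((u \<bullet> x)\<^sup>2) \<partial>gaussian)"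
    using False by (intro nn_integral_cong) (simp add: u_def power_mult_distrib field_simps flip: ennreal_mult')
  also have "\<dots> = ennreal ((norm y)\<^sup>2) * (\<integral>\<^sup>+x. ennreal ((u \<bullet> x)\<^sup>2) \<partial>gaussian)"
    by (rule nn_integral_cmult) simp
  also have "(\<integral>\<^sup>+x. ennreal ((u \<bullet> x)\<^sup>2) \<partial>gaussian) \<le> (\<integral>\<^sup>+x. 2 * (ennreal (exp (u \<bullet> x)) + ennreal (exp (- u \<bullet> x))) \<partial>gaussian)"
    using sq by (intro nn_integral_mono) (simp add: ennreal_plus[symmetric] ennreal_mult'[symmetric] ennreal_numeral[symmetric] del: ennreal_plus ennreal_numeral)
  also have "\<dots> = ennreal (4 * exp (1/2))"
    using u gaussian_mgf[of u] gaussian_mgf[of "-u"]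
    by (simp add: nn_integral_cmult nn_integral_add)
      (simp add: ennreal_plus[symmetric] ennreal_mult'[symmetric] ennreal_numeral[symmetric] del: ennreal_plus ennreal_numeral)
  also have "ennreal ((norm y)\<^sup>2) * ennreal (4 * exp (1/2)) \<le> ennreal (8 * (norm y)\<^sup>2)"
    using \<open>exp (1/2) \<le> 2\<close> mult_left_mono[of "exp (1/2)" 2 "(norm y)\<^sup>2"]
    by (simp add: ennreal_mult'[symmetric] mult.commute)
  finally show ?thesis by (simp add: mult_left_mono)
qed simp


text \<open>The bound is \<open>1 + t \<le> exp t\<close> for \<open>t\<close> the deviation of the shifted exponent from its mean.\<close>
lemma gaussian_variational_bound:
  fixes H :: "'a::euclidean_space \<Rightarrow> real"
  assumes [measurable]: "H \<in> borel_measurable borel" and bound: "\<And>x. \<bar>H x\<bar> \<le> C"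
    and K: "K > 0" "(\<integral>\<^sup>+x. ennreal (exp (H x)) \<partial>gaussian) \<le> ennreal K"
  shows "(\<integral>x. H (w + x) \<partial>gaussian) \<le> ln K + (norm w)\<^sup>2 / 2"
proof -
  interpret prob_space "gaussian :: 'a measure" by (rule prob_space_gaussian)
  \<comment> \<open>By \<open>gaussian_shift\<close>, the integral of \<open>exp (h x)\<close>
    equals that of \<open>exp (H x)\<close>. The linear term of \<open>h\<close> integrates to zero,
    so \<open>a\<close> is the mean of \<open>h\<close>.\<close>
  define h where "h x = H (w + x) - w \<bullet> x - (norm w)\<^sup>2 / 2" for x
  define a where "a = (\<integral>x. H (w + x) \<partial>gaussian) - (norm w)\<^sup>2 / 2"
  have h_mble [measurable]: "h \<in> borel_measurable borel" unfolding h_def by measurable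
  have iH: "integrable gaussian (\<lambda>x. H (w + x))"
    by (rule integrable_const_bound[of _ C]) (simp_all add: bound)
  have ih: "integrable gaussian h"
    unfolding h_def using iH gaussian_integrable_inner[of w] by simp
  have ha: "(\<integral>x. h x \<partial>gaussian) = a"
    unfolding h_def a_def using iH gaussian_integrable_inner[of w] gaussian_mean[of w] prob_space
    by (simp add: Bochner_Integration.integral_diff)
  have le: "(\<integral>\<^sup>+x. ennreal (exp (h x)) \<partial>gaussian) \<le> ennreal K"
    using K(2) unfolding h_def
    by (subst (asm) gaussian_shift[of _ w])
      (simp_all add: ennreal_mult'[symmetric] exp_add[symmetric] algebra_simps)
  then have ie: "integrable gaussian (\<lambda>x. exp (h x))"
    by (intro integrableI_bounded) (auto simp: top_unique less_top[symmetric])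
  have "exp a = (\<integral>x. exp a * (1 + (h x - a)) \<partial>gaussian)"
    using ih ha prob_space by simp
  also have "\<dots> \<le> (\<integral>x. exp (h x) \<partial>gaussian)"
  proof (rule integral_mono)
    fix x
    have "exp a * (1 + (h x - a)) \<le> exp a * exp (h x - a)"
      by (intro mult_left_mono exp_ge_add_one_self) simp
    then show "exp a * (1 + (h x - a)) \<le> exp (h x)" by (simp flip: exp_add)
  qed (use ih ie in auto)
  also have "\<dots> \<le> K"
    using le K(1) nn_integral_eq_integral[OF ie] by simp
  finally have "a \<le> ln K" using K(1) by (simp add: ln_ge_iff)
  then show ?thesis by (simp add: a_def)
qed

section \<open>Half-spaces and independent vectors\<close>

text \<open>The event is fixed before the direction \<open>v\<close>, which is what makes the bound
  uniform. A larger \<open>\<beta>\<close> raises the shift cost \<open>\<beta> / 2\<close> but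
  damps the noise contribution \<open>8 * T / \<beta>\<close>. The outer factor 2 compensates for
  hitting a point of the half-space with probability only \<open>1 / 2\<close>.\<close>

lemma (in prob_space) uniform_halfspace_count:
  fixes Y :: "'i \<Rightarrow> 'a \<Rightarrow> 'b::euclidean_space"
  assumes fin: "finite I" and indep: "indep_vars (\<lambda>_. borel) Y I"
    and \<delta>: "0 < \<delta>" and s: "0 < s" and \<beta>: "0 < \<beta>" and V0: "0 \<le> V" and T0: "0 \<le> T"
    and V: "\<And>j u. j \<in> I \<Longrightarrow> (\<integral>\<^sup>+\<omega>. ennreal ((u \<bullet> Y j \<omega>)\<^sup>2) \<partial>M) \<le> ennreal (V * (norm u)\<^sup>2)"
    and T: "\<And>j. j \<in> I \<Longrightarrow> (\<integral>\<^sup>+\<omega>. ennreal ((norm (Y j \<omega>))\<^sup>2) \<partial>M) \<le> ennreal T"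
  obtains E where "E \<in> events" "prob E \<ge> 1 - \<delta>"
    "\<And>\<omega> v. \<omega> \<in> E \<Longrightarrow> norm v = 1 \<Longrightarrow>
      real (card {j\<in>I. v \<bullet> Y j \<omega> > s}) \<le> 2 * (ln (1 / \<delta>) + \<beta> / 2 + 2 * real (card I) * (2 * (V + 8 * T / \<beta>) / s\<^sup>2))"
proof -
  interpret \<gamma>: prob_space "gaussian :: 'b measure" by (rule prob_space_gaussian)
  interpret pair_sigma_finite M "gaussian :: 'b measure" ..
  have Y_mble [measurable]: "j \<in> I \<Longrightarrow> Y j \<in> borel_measurable M" for j
    using indep by (simp add: indep_vars_def)
  \<comment> \<open>The random direction is centred at \<open>sqrt \<beta> *\<^sub>R v\<close>, so
    the threshold \<open>s\<close> is scaled by the same factor.\<close>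
  define r where "r = sqrt \<beta> * s"
  have r: "r > 0" using s \<beta> by (simp add: r_def)
  have r2: "r\<^sup>2 = \<beta> * s\<^sup>2" using \<beta> by (simp add: r_def power_mult_distrib)
  define p :: "'i \<Rightarrow> 'b \<Rightarrow> real" where "p j \<theta> = (\<integral>\<omega>. of_bool (\<theta> \<bullet> Y j \<omega> > r) \<partial>M)" for j \<theta>
  \<comment> \<open>Subtracting twice the mean makes the expectation of
    \<open>exp (H \<omega> \<theta>)\<close> at most 1 for each fixed \<open>\<theta>\<close>. For a
    truth value \<open>b\<close>, \<open>exp b = 1 + (exp 1 - 1) * b\<close>, and
    \<open>1 + (exp 1 - 1) * p \<le> 1 + 2 * p \<le> exp (2 * p)\<close> because
    \<open>exp 1 \<le> 3\<close>.\<close>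
  define H where "H \<omega> \<theta> = (\<Sum>j\<in>I. of_bool (\<theta> \<bullet> Y j \<omega> > r) - 2 * p j \<theta>)" for \<omega> \<theta>
  have int_bool: "integrable M (\<lambda>\<omega>. of_bool (\<theta> \<bullet> Y j \<omega> > r) :: real)" if [simp]: "j \<in> I" for j \<theta>
    by (rule integrable_const_bound[of _ 1]) auto
  have p_mble [measurable]: "j \<in> I \<Longrightarrow> p j \<in> borel_measurable borel" for j
    unfolding p_def by measurable
  have p01: "0 \<le> p j \<theta>" "p j \<theta> \<le> 1" if "j \<in> I" for j \<theta>
    using integral_mono[OF int_bool[OF that, of \<theta>], of "\<lambda>_. 1"] prob_space by (simp_all add: p_def)
  have H_mble [measurable]: "(\<lambda>(\<omega>, \<theta>). H \<omega> \<theta>) \<in> borel_measurable (M \<Otimes>\<^sub>M borel)"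
    unfolding H_def by measurable
  have H_mble' [measurable]: "H \<omega> \<in> borel_measurable borel" for \<omega>
    unfolding H_def by measurable
  have H_bound: "\<bar>H \<omega> \<theta>\<bar> \<le> real (card I) * 2" for \<omega> \<theta>
  proof -
    have "\<bar>H \<omega> \<theta>\<bar> \<le> (\<Sum>j\<in>I. \<bar>of_bool (\<theta> \<bullet> Y j \<omega> > r) - 2 * p j \<theta>\<bar>)"
      unfolding H_def by (rule sum_abs)
    also have "\<dots> \<le> (\<Sum>j\<in>I. 2)"
      using p01[of _ \<theta>] by (intro sum_mono) (force simp: abs_le_iff)
    finally show ?thesis by simp
  qed
  \<comment> \<open>The average is over the centred Gaussian, so \<open>G\<close> does not involve
    \<open>v\<close>: a single use of Markov's inequality serves all directions.\<close>
  define G where "G \<omega> = (\<integral>\<^sup>+\<theta>. ennreal (exp (H \<omega> \<theta>)) \<partial>gaussian)" for \<omega>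
  have G_mble [measurable]: "G \<in> borel_measurable M"
    unfolding G_def by measurable
  have mgf: "(\<integral>\<^sup>+\<omega>. ennreal (exp (H \<omega> \<theta>)) \<partial>M) \<le> 1" for \<theta>
  proof -
    have "indep_vars (\<lambda>_. borel) (\<lambda>j \<omega>. ennreal (exp (of_bool (\<theta> \<bullet> Y j \<omega> > r) - 2 * p j \<theta>))) I"
      by (rule indep_vars_compose2[OF indep]) simp
    then have "(\<integral>\<^sup>+\<omega>. ennreal (exp (H \<omega> \<theta>)) \<partial>M)
      = (\<Prod>j\<in>I. \<integral>\<^sup>+\<omega>. ennreal (exp (of_bool (\<theta> \<bullet> Y j \<omega> > r) - 2 * p j \<theta>)) \<partial>M)"
      unfolding H_def exp_sum[OF fin] by (subst indep_vars_nn_integral[OF fin, symmetric]) (simp_all add: prod_ennreal)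
    also have "\<dots> \<le> (\<Prod>j\<in>I. 1)"
    proof (rule prod_mono_ennreal)
      fix j assume j: "j \<in> I"
      have "(\<integral>\<^sup>+\<omega>. ennreal (exp (of_bool (\<theta> \<bullet> Y j \<omega> > r) - 2 * p j \<theta>)) \<partial>M)
        = (\<integral>\<^sup>+\<omega>. ennreal (exp (- 2 * p j \<theta>) * (1 + (exp 1 - 1) * of_bool (\<theta> \<bullet> Y j \<omega> > r))) \<partial>M)"
        by (intro nn_integral_cong) (auto simp: of_bool_def exp_add[symmetric] algebra_simps)
      also have "\<dots> = ennreal (\<integral>\<omega>. exp (- 2 * p j \<theta>) * (1 + (exp 1 - 1) * of_bool (\<theta> \<bullet> Y j \<omega> > r)) \<partial>M)"
        using int_bool[OF j] by (intro nn_integral_eq_integral) (auto intro!: AE_I2)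
      also have "\<dots> = ennreal (exp (- 2 * p j \<theta>) * (1 + (exp 1 - 1) * p j \<theta>))"
        using int_bool[OF j] prob_space by (simp add: p_def)
      also have "\<dots> \<le> ennreal (exp (- 2 * p j \<theta>) * exp (2 * p j \<theta>))"
      proof (intro ennreal_leI mult_left_mono)
        have "(exp 1 - 1) * p j \<theta> \<le> 2 * p j \<theta>"
          using exp_le p01[OF j] by (intro mult_right_mono) auto
        then show "1 + (exp 1 - 1) * p j \<theta> \<le> exp (2 * p j \<theta>)"
          using exp_ge_add_one_self[of "2 * p j \<theta>"] by linarith
      qed simp
      finally show "(\<integral>\<^sup>+\<omega>. ennreal (exp (of_bool (\<theta> \<bullet> Y j \<omega> > r) - 2 * p j \<theta>)) \<partial>M) \<le> 1"
        by (simp flip: exp_add)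
    qed
    finally show ?thesis by simp
  qed
  have "(\<integral>\<^sup>+\<omega>. G \<omega> \<partial>M) = (\<integral>\<^sup>+\<theta>. (\<integral>\<^sup>+\<omega>. ennreal (exp (H \<omega> \<theta>)) \<partial>M) \<partial>gaussian)"
    unfolding G_def by (rule Fubini'[symmetric]) simp
  also have "\<dots> \<le> (\<integral>\<^sup>+\<theta>. 1 \<partial>(gaussian :: 'b measure))"
    by (intro nn_integral_mono mgf)
  finally have EG: "(\<integral>\<^sup>+\<omega>. G \<omega> \<partial>M) \<le> 1" using \<gamma>.emeasure_space_1 by simp
  define E where "E = {\<omega>\<in>space M. G \<omega> \<le> ennreal (1 / \<delta>)}"
  have E_ev [measurable]: "E \<in> events" unfolding E_def by measurable
  have "emeasure M (space M - E) \<le> emeasure M {\<omega>\<in>space M. 1 \<le> ennreal \<delta> * G \<omega>}"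
  proof (intro emeasure_mono subsetI)
    fix \<omega> assume "\<omega> \<in> space M - E"
    then have "ennreal (1 / \<delta>) \<le> G \<omega>" "\<omega> \<in> space M" by (auto simp: E_def)
    then have "ennreal \<delta> * ennreal (1 / \<delta>) \<le> ennreal \<delta> * G \<omega>" by (intro mult_left_mono) auto
    then show "\<omega> \<in> {\<omega>\<in>space M. 1 \<le> ennreal \<delta> * G \<omega>}"
      using \<delta> \<open>\<omega> \<in> space M\<close> by (simp flip: ennreal_mult')
  qed measurable
  also have "\<dots> \<le> ennreal \<delta> * (\<integral>\<^sup>+\<omega>. G \<omega> * indicator (space M) \<omega> \<partial>M)"
    by (rule nn_integral_Markov_inequality) auto
  also have "\<dots> = ennreal \<delta> * (\<integral>\<^sup>+\<omega>. G \<omega> \<partial>M)"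
    by (intro arg_cong2[of _ _ _ _ "(*)"] nn_integral_cong refl) simp
  also have "\<dots> \<le> ennreal \<delta>" using mult_left_mono[OF EG, of "ennreal \<delta>"] by simp
  finally have "prob (space M - E) \<le> \<delta>" using \<delta> by (simp add: emeasure_eq_measure)
  then have "prob E \<ge> 1 - \<delta>" using prob_compl[OF E_ev] by simp
  moreover have "real (card {j\<in>I. v \<bullet> Y j \<omega> > s}) \<le> 2 * (ln (1 / \<delta>) + \<beta> / 2 + 2 * real (card I) * (2 * (V + 8 * T / \<beta>) / s\<^sup>2))"
    if \<omega>: "\<omega> \<in> E" and v: "norm v = 1" for \<omega> v
  proof -
    define w where "w = sqrt \<beta> *\<^sub>R v"
    have w: "(norm w)\<^sup>2 = \<beta>" using \<beta> v by (simp add: w_def)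
    have "(\<integral>x. H \<omega> (w + x) \<partial>gaussian) \<le> ln (1 / \<delta>) + (norm w)\<^sup>2 / 2"
      using \<omega> \<delta> by (intro gaussian_variational_bound[OF _ H_bound]) (auto simp: E_def G_def)
    moreover
    define P :: "'i \<Rightarrow> real" where "P j = (\<integral>x. of_bool ((w + x) \<bullet> Y j \<omega> > r) \<partial>gaussian)" for j
    define q where "q j = (\<integral>x. p j (w + x) \<partial>gaussian)" for j
    have iP: "integrable gaussian (\<lambda>x. of_bool ((w + x) \<bullet> Y j \<omega> > r) :: real)" for j
      by (rule \<gamma>.integrable_const_bound[of _ 1]) auto
    have iq: "integrable gaussian (\<lambda>x. p j (w + x))" if "j \<in> I" for j
      using that p01 by (intro \<gamma>.integrable_const_bound[of _ 1]) auto
    have "(\<integral>x. H \<omega> (w + x) \<partial>gaussian) = (\<Sum>j\<in>I. P j - 2 * q j)"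
      unfolding H_def P_def q_def using iP iq by (subst Bochner_Integration.integral_sum) auto
    \<comment> \<open>If \<open>w \<bullet> Y j \<omega>\<close> already exceeds \<open>r\<close>,
      any noise \<open>x\<close> with \<open>Y j \<omega> \<bullet> x \<ge> 0\<close> keeps the sum
      above \<open>r\<close>.\<close>
    moreover have "of_bool (v \<bullet> Y j \<omega> > s) / 2 \<le> P j" for j
    proof (cases "v \<bullet> Y j \<omega> > s")
      case True
      then have "w \<bullet> Y j \<omega> > r" using \<beta> by (simp add: w_def r_def)
      then have "(\<integral>x. indicator {x. Y j \<omega> \<bullet> x \<ge> 0} x \<partial>gaussian) \<le> P j"
        unfolding P_def by (intro integral_mono[OF \<gamma>.integrable_const_bound[of _ 1] iP]) (auto simp: indicator_def inner_add inner_commute less_top[symmetric])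
      then show ?thesis using gaussian_half_space[of "Y j \<omega>"] True by simp
    qed (simp add: P_def)
    \<comment> \<open>Chebyshev's inequality in both variables. Splitting by
      \<open>(a + b)\<^sup>2 \<le> 2 * (a\<^sup>2 + b\<^sup>2)\<close>, the shift \<open>w\<close>
      contributes \<open>V * \<beta>\<close> and the noise contributes \<open>8 * T\<close>; the
      division is by \<open>r\<^sup>2 = \<beta> * s\<^sup>2\<close>.\<close>
    moreover have "q j \<le> 2 * (V + 8 * T / \<beta>) / s\<^sup>2" if j [simp]: "j \<in> I" for j
    proof -
      have "ennreal (q j) = (\<integral>\<^sup>+x. ennreal (p j (w + x)) \<partial>gaussian)"
        unfolding q_def using iq[OF j] p01[OF j] by (intro nn_integral_eq_integral[symmetric]) auto
      also have "\<dots> = (\<integral>\<^sup>+x. \<integral>\<^sup>+\<omega>. ennreal (of_bool ((w + x) \<bullet> Y j \<omega> > r)) \<partial>M \<partial>gaussian)"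
        unfolding p_def using int_bool[OF j] by (intro nn_integral_cong nn_integral_eq_integral[symmetric]) auto
      also have "\<dots> \<le> (\<integral>\<^sup>+x. \<integral>\<^sup>+\<omega>. ennreal (2 / r\<^sup>2) * (ennreal ((w \<bullet> Y j \<omega>)\<^sup>2) + ennreal ((Y j \<omega> \<bullet> x)\<^sup>2)) \<partial>M \<partial>gaussian)"
      proof (intro nn_integral_mono)
        fix x \<omega>
        have "of_bool ((w + x) \<bullet> Y j \<omega> > r) \<le> ((w + x) \<bullet> Y j \<omega>)\<^sup>2 / r\<^sup>2"
          using r power_mono[of r "(w + x) \<bullet> Y j \<omega>" 2] by (simp add: of_bool_def)
        also have "\<dots> \<le> (2 * ((w \<bullet> Y j \<omega>)\<^sup>2 + (Y j \<omega> \<bullet> x)\<^sup>2)) / r\<^sup>2"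
          using sum_squares_ge_zero[of "w \<bullet> Y j \<omega> - Y j \<omega> \<bullet> x" 0]
          by (intro divide_right_mono) (simp_all add: inner_add inner_commute power2_eq_square algebra_simps)
        finally show "ennreal (of_bool ((w + x) \<bullet> Y j \<omega> > r)) \<le> ennreal (2 / r\<^sup>2) * (ennreal ((w \<bullet> Y j \<omega>)\<^sup>2) + ennreal ((Y j \<omega> \<bullet> x)\<^sup>2))"
          by (simp add: ennreal_mult'[symmetric] ennreal_plus[symmetric] ennreal_leI del: ennreal_plus)
      qed
      also have "\<dots> = (\<integral>\<^sup>+\<omega>. \<integral>\<^sup>+x. ennreal (2 / r\<^sup>2) * (ennreal ((w \<bullet> Y j \<omega>)\<^sup>2) + ennreal ((Y j \<omega> \<bullet> x)\<^sup>2)) \<partial>gaussian \<partial>M)"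
        by (rule Fubini') simp
      also have "\<dots> = (\<integral>\<^sup>+\<omega>. ennreal (2 / r\<^sup>2) * (ennreal ((w \<bullet> Y j \<omega>)\<^sup>2) + (\<integral>\<^sup>+x. ennreal ((Y j \<omega> \<bullet> x)\<^sup>2) \<partial>gaussian)) \<partial>M)"
        using \<gamma>.emeasure_space_1 by (simp add: nn_integral_cmult nn_integral_add)
      also have "\<dots> \<le> (\<integral>\<^sup>+\<omega>. ennreal (2 / r\<^sup>2) * (ennreal ((w \<bullet> Y j \<omega>)\<^sup>2) + ennreal (8 * (norm (Y j \<omega>))\<^sup>2)) \<partial>M)"
        by (intro nn_integral_mono mult_left_mono add_left_mono gaussian_second_moment) simp
      also have "\<dots> = ennreal (2 / r\<^sup>2) * ((\<integral>\<^sup>+\<omega>. ennreal ((w \<bullet> Y j \<omega>)\<^sup>2) \<partial>M) + ennreal 8 * (\<integral>\<^sup>+\<omega>. ennreal ((norm (Y j \<omega>))\<^sup>2) \<partial>M))"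
        by (simp add: nn_integral_cmult nn_integral_add ennreal_mult)
      also have "\<dots> \<le> ennreal (2 / r\<^sup>2) * (ennreal (V * (norm w)\<^sup>2) + ennreal 8 * ennreal T)"
        by (intro mult_left_mono add_mono V T j) auto
      also have "\<dots> = ennreal (2 / r\<^sup>2 * (V * \<beta> + 8 * T))"
        using V0 T0 \<beta> by (simp only: w ennreal_mult[symmetric] ennreal_plus[symmetric] mult_nonneg_nonneg
            add_nonneg_nonneg less_imp_le zero_le_numeral zero_le_power2 divide_nonneg_nonneg)
      finally have "q j \<le> 2 / r\<^sup>2 * (V * \<beta> + 8 * T)"
        using V0 T0 \<beta> by (subst (asm) ennreal_le_iff) auto
      also have "\<dots> = 2 * (V + 8 * T / \<beta>) / s\<^sup>2"
        using \<beta> s by (simp add: r2 field_simps)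
      finally show ?thesis .
    qed
    ultimately have PQ: "(\<Sum>j\<in>I. P j) - 2 * (\<Sum>j\<in>I. q j) \<le> ln (1 / \<delta>) + \<beta> / 2"
      and P: "\<And>j. of_bool (v \<bullet> Y j \<omega> > s) / 2 \<le> P j"
      and q: "\<And>j. j \<in> I \<Longrightarrow> q j \<le> 2 * (V + 8 * T / \<beta>) / s\<^sup>2"
      using w by (simp_all add: sum_subtractf sum_distrib_left)
    have "real (card {j\<in>I. v \<bullet> Y j \<omega> > s}) = 2 * (\<Sum>j\<in>I. of_bool (v \<bullet> Y j \<omega> > s) / 2)"
      using fin by (simp add: sum_distrib_left Int_def)
    also have "\<dots> \<le> 2 * (\<Sum>j\<in>I. P j)" by (intro mult_left_mono sum_mono P) simp
    also have "\<dots> \<le> 2 * (ln (1 / \<delta>) + \<beta> / 2 + 2 * (\<Sum>j\<in>I. q j))" using PQ by simp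
    also have "\<dots> \<le> 2 * (ln (1 / \<delta>) + \<beta> / 2 + 2 * (real (card I) * (2 * (V + 8 * T / \<beta>) / s\<^sup>2)))"
      by (intro mult_left_mono add_left_mono sum_bounded_above q) auto
    finally show ?thesis by (simp add: mult.assoc)
  qed
  ultimately show thesis using E_ev by (intro that)
qed

section \<open>Second moments of block means\<close>

text \<open>Expanding the square in coordinates produces exactly the products whose integrability
  \<open>has_covariance\<close> supplies.\<close>

lemma covariance_quadratic_form:
  fixes D :: "(real ^ 'd) measure"
  assumes "has_covariance D"
  shows "integrable D (\<lambda>x. (u \<bullet> (x - mean D))\<^sup>2)"
    and "(\<integral>x. (u \<bullet> (x - mean D))\<^sup>2 \<partial>D) = u \<bullet> (covariance_matrix D *v u)"
proof -
  have eq: "(u \<bullet> (x - mean D))\<^sup>2 = (\<Sum>p\<in>UNIV. \<Sum>q\<in>UNIV. (u $ p * u $ q) * ((x - mean D) $ p * (x - mean D) $ q))" for x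
    by (simp add: inner_vec_def power2_eq_square sum_product ac_simps)
  have int: "integrable D (\<lambda>x. (u $ p * u $ q) * ((x - mean D) $ p * (x - mean D) $ q))" for p q
    using assms unfolding has_covariance_def by (intro integrable_mult_right) blast
  show "integrable D (\<lambda>x. (u \<bullet> (x - mean D))\<^sup>2)"
    unfolding eq by (intro Bochner_Integration.integrable_sum int)
  show "(\<integral>x. (u \<bullet> (x - mean D))\<^sup>2 \<partial>D) = u \<bullet> (covariance_matrix D *v u)"
    unfolding eq using int
    by (simp add: Bochner_Integration.integral_sum Bochner_Integration.integrable_sum del: integral_mult_right_zero integrable_mult_right_iff)
      (simp add: inner_vec_def matrix_vector_mult_def covariance_matrix_def sum_distrib_left ac_simps)
qed

lemma transpose_covariance_matrix: "transpose (covariance_matrix D) = covariance_matrix D"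
  by (simp add: transpose_def covariance_matrix_def mult.commute)

text \<open>Converts directional second moments along the coordinate axes into the expected squared
  norm.\<close>

lemma trace_eq_sum_quadratic_form:
  fixes A :: "real ^ 'd ^ 'd"
  shows "trace A = (\<Sum>p\<in>UNIV. axis p 1 \<bullet> (A *v axis p 1))"
  by (simp add: trace_def inner_axis' matrix_vector_mult_basis column_def)

text \<open>Induction on the index set: the cross term has expectation zero, since the new summand
  is centred and independent of the partial sum.\<close>

lemma (in prob_space) second_moment_indep_sum:
  fixes \<xi> :: "'i \<Rightarrow> 'a \<Rightarrow> real"
  assumes "finite I" "indep_vars (\<lambda>_. borel) \<xi> I"
    and "\<And>i. i \<in> I \<Longrightarrow> integrable M (\<lambda>\<omega>. (\<xi> i \<omega>)\<^sup>2)" "\<And>i. i \<in> I \<Longrightarrow> expectation (\<xi> i) = 0"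
  shows "integrable M (\<lambda>\<omega>. (\<Sum>i\<in>I. \<xi> i \<omega>)\<^sup>2) \<and>
    expectation (\<lambda>\<omega>. (\<Sum>i\<in>I. \<xi> i \<omega>)\<^sup>2) = (\<Sum>i\<in>I. expectation (\<lambda>\<omega>. (\<xi> i \<omega>)\<^sup>2))"
  using assms
proof (induction I rule: finite_induct)
  case (insert i I)
  have mble [measurable]: "j \<in> insert i I \<Longrightarrow> \<xi> j \<in> borel_measurable M" for j
    using insert.prems(1) unfolding indep_vars_def by blast
  have int: "integrable M (\<xi> j)" if "j \<in> insert i I" for j
    by (rule square_integrable_imp_integrable[OF mble[OF that] insert.prems(2)[OF that]])
  have IH: "integrable M (\<lambda>\<omega>. (\<Sum>i\<in>I. \<xi> i \<omega>)\<^sup>2)"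
    "expectation (\<lambda>\<omega>. (\<Sum>i\<in>I. \<xi> i \<omega>)\<^sup>2) = (\<Sum>i\<in>I. expectation (\<lambda>\<omega>. (\<xi> i \<omega>)\<^sup>2))"
    using insert.IH[OF indep_vars_subset[OF insert.prems(1) subset_insertI]] insert.prems(2,3) by simp_all
  have iS: "integrable M (\<lambda>\<omega>. \<Sum>i\<in>I. \<xi> i \<omega>)" using int by (intro Bochner_Integration.integrable_sum) simp
  have indep: "indep_var borel (\<xi> i) borel (\<lambda>\<omega>. \<Sum>i\<in>I. \<xi> i \<omega>)"
    by (rule indep_vars_sum[OF insert.hyps insert.prems(1)])
  have cross: "integrable M (\<lambda>\<omega>. \<xi> i \<omega> * (\<Sum>i\<in>I. \<xi> i \<omega>))"
    "expectation (\<lambda>\<omega>. \<xi> i \<omega> * (\<Sum>i\<in>I. \<xi> i \<omega>)) = 0"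
    using indep_var_integrable[OF indep int iS] indep_var_lebesgue_integral[OF indep int iS] insert.prems(3)[of i]
    by simp_all
  have eq: "(\<Sum>i\<in>insert i I. \<xi> i \<omega>)\<^sup>2 = (\<xi> i \<omega>)\<^sup>2 + 2 * (\<xi> i \<omega> * (\<Sum>i\<in>I. \<xi> i \<omega>)) + (\<Sum>i\<in>I. \<xi> i \<omega>)\<^sup>2" for \<omega>
    using insert.hyps by (simp add: power2_sum)
  show ?case
    unfolding eq using insert.hyps insert.prems(2) IH cross by simp
qed simp

lemma (in prob_space) block_mean_second_moment:
  fixes X :: "'i \<Rightarrow> 'a \<Rightarrow> real ^ 'd"
  assumes "finite C" "C \<noteq> {}" and indep: "indep_vars (\<lambda>_. borel) X C"
    and D: "\<And>i. i \<in> C \<Longrightarrow> distr M borel (X i) = D" and cov: "has_covariance D"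
  shows "(\<integral>\<^sup>+\<omega>. ennreal ((u \<bullet> ((1 / real (card C)) *\<^sub>R (\<Sum>i\<in>C. X i \<omega>) - mean D))\<^sup>2) \<partial>M)
    = ennreal (u \<bullet> (covariance_matrix D *v u) / real (card C))"
proof -
  define \<xi> where "\<xi> i \<omega> = u \<bullet> (X i \<omega> - mean D)" for i \<omega>
  have X_mble [measurable]: "i \<in> C \<Longrightarrow> X i \<in> borel_measurable M" for i
    using indep by (simp add: indep_vars_def)
  \<comment> \<open>\<open>D\<close> is known only as the law of the \<open>X i\<close>; one index
    of the block shows that it is a Borel probability measure.\<close>
  obtain i0 where i0: "i0 \<in> C" using \<open>C \<noteq> {}\<close> by blast
  have D_sets [simp, measurable_cong]: "sets D = sets borel"
    unfolding D[OF i0, symmetric] by simp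
  have "prob_space D"
    unfolding D[OF i0, symmetric] using i0 by (intro prob_space_distr) simp
  interpret D: prob_space D by fact
  have int_id: "integrable D (\<lambda>x. x)" using cov by (simp add: has_covariance_def)
  have zero: "(\<integral>x. u \<bullet> (x - mean D) \<partial>D) = 0"
    using int_id D.prob_space by (simp add: inner_diff_right mean_def)
  have "expectation (\<xi> i) = 0" if "i \<in> C" for i
    using zero that unfolding D[OF that, symmetric] \<xi>_def by (simp add: integral_distr)
  moreover have sq: "integrable M (\<lambda>\<omega>. (\<xi> i \<omega>)\<^sup>2)" "expectation (\<lambda>\<omega>. (\<xi> i \<omega>)\<^sup>2) = u \<bullet> (covariance_matrix D *v u)"
    if i: "i \<in> C" for i
  proof -
    show "integrable M (\<lambda>\<omega>. (\<xi> i \<omega>)\<^sup>2)"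
      unfolding \<xi>_def using covariance_quadratic_form(1)[OF cov, of u] i
      by (subst integrable_distr_eq[where g = "X i" and N = borel and f = "\<lambda>x. (u \<bullet> (x - mean D))\<^sup>2", symmetric]) (simp_all add: D)
    have "expectation (\<lambda>\<omega>. (\<xi> i \<omega>)\<^sup>2) = (\<integral>x. (u \<bullet> (x - mean D))\<^sup>2 \<partial>distr M borel (X i))"
      unfolding \<xi>_def using i by (subst integral_distr) simp_all
    then show "expectation (\<lambda>\<omega>. (\<xi> i \<omega>)\<^sup>2) = u \<bullet> (covariance_matrix D *v u)"
      using covariance_quadratic_form(2)[OF cov] i by (simp add: D)
  qed
  moreover have "indep_vars (\<lambda>_. borel) \<xi> C"
    unfolding \<xi>_def by (rule indep_vars_compose2[OF indep]) simp
  ultimately have sum: "integrable M (\<lambda>\<omega>. (\<Sum>i\<in>C. \<xi> i \<omega>)\<^sup>2)"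
    "expectation (\<lambda>\<omega>. (\<Sum>i\<in>C. \<xi> i \<omega>)\<^sup>2) = real (card C) * (u \<bullet> (covariance_matrix D *v u))"
    using second_moment_indep_sum[OF \<open>finite C\<close>, of \<xi>] by simp_all
  have c: "real (card C) > 0" using assms(1,2) by (simp add: card_gt_0_iff)
  have eq: "(u \<bullet> ((1 / real (card C)) *\<^sub>R (\<Sum>i\<in>C. X i \<omega>) - mean D))\<^sup>2 = (1 / real (card C))\<^sup>2 * (\<Sum>i\<in>C. \<xi> i \<omega>)\<^sup>2" for \<omega>
    using c by (simp add: \<xi>_def inner_diff_right inner_sum_right sum_subtractf power_mult_distrib[symmetric] field_simps)
  show ?thesis
    unfolding eq using sum c
    by (subst nn_integral_eq_integral) (simp_all add: power2_eq_square)
qed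

section \<open>The median-of-means tournament\<close>

text \<open>The largest admissible \<open>J\<close> collects all indices with strict inequality. A
  majority is never empty, so \<open>MIN\<close> is taken over a nonempty finite set.\<close>

lemma mem_S_set_iff:
  "x \<in> S_set k Z a \<longleftrightarrow> real k / 2 < real (card {j\<in>{1..k}. norm (Z j - a) < norm (Z j - x)})"
proof
  assume "x \<in> S_set k Z a"
  then obtain J where J: "J \<subseteq> {1..k}" "real (card J) > real k / 2"
    and min: "(MIN j\<in>J. norm (Z j - x) - norm (Z j - a)) > 0"
    unfolding S_set_def by blast
  have "finite J" "J \<noteq> {}" using J finite_subset[OF J(1)] by auto
  then have "J \<subseteq> {j\<in>{1..k}. norm (Z j - a) < norm (Z j - x)}"
    using min J(1) by (auto simp: Min_gr_iff)
  then have "card J \<le> card {j\<in>{1..k}. norm (Z j - a) < norm (Z j - x)}"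
    by (rule card_mono[rotated]) simp
  then show "real k / 2 < real (card {j\<in>{1..k}. norm (Z j - a) < norm (Z j - x)})"
    using J(2) by linarith
next
  let ?J = "{j\<in>{1..k}. norm (Z j - a) < norm (Z j - x)}"
  assume card: "real k / 2 < real (card ?J)"
  then have "?J \<noteq> {}" by (metis card.empty of_nat_0 not_le of_nat_0_le_iff divide_nonneg_pos zero_less_numeral)
  then have "(MIN j\<in>?J. norm (Z j - x) - norm (Z j - a)) > 0"
    by (subst Min_gr_iff) auto
  then show "x \<in> S_set k Z a"
    unfolding S_set_def using card by (auto intro!: exI[of _ ?J])
qed

text \<open>Every \<open>Z j\<close> is closer to \<open>a\<close> than to a sufficiently remote
  \<open>x\<close>. Boundedness is required before distances can be compared with
  \<open>diameter\<close>; for \<open>k = 0\<close> the complement would be the whole space.\<close>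

lemma bounded_Compl_S_set:
  assumes "k \<ge> 1"
  shows "bounded (- S_set k Z a)"
proof -
  have "norm x \<le> (\<Sum>j\<in>{1..k}. 2 * norm (Z j)) + norm a" if "x \<notin> S_set k Z a" for x
  proof (rule ccontr)
    assume far: "\<not> norm x \<le> (\<Sum>j\<in>{1..k}. 2 * norm (Z j)) + norm a"
    have "norm (Z j - a) < norm (Z j - x)" if "j \<in> {1..k}" for j
    proof -
      have "2 * norm (Z j) \<le> (\<Sum>j\<in>{1..k}. 2 * norm (Z j))"
        using that by (intro member_le_sum) auto
      then show ?thesis
        using far norm_triangle_ineq4[of "Z j" a] norm_triangle_ineq2[of x "Z j"]
        by (simp add: norm_minus_commute)
    qed
    then have "{j\<in>{1..k}. norm (Z j - a) < norm (Z j - x)} = {1..k}" by auto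
    then show False using that \<open>k \<ge> 1\<close> by (simp add: mem_S_set_iff)
  qed
  then show ?thesis by (auto simp: bounded_iff)
qed

lemma mean_estimate_close:
  fixes \<mu> :: "real ^ 'd"
  assumes est: "is_mean_estimate k Z a" and k: "k \<ge> 1" and \<rho>: "0 \<le> \<rho>"
    and cnt: "\<And>v. norm v = 1 \<Longrightarrow> real (card {j\<in>{1..k}. v \<bullet> (Z j - \<mu>) > \<rho> / 2}) < real k / 2"
  shows "norm (a - \<mu>) \<le> 2 * \<rho>"
proof -
  have near: "norm (x - \<mu>) \<le> \<rho>" if "x \<notin> S_set k Z \<mu>" for x
  proof (rule ccontr)
    assume far: "\<not> norm (x - \<mu>) \<le> \<rho>"
    define v where "v = (x - \<mu>) /\<^sub>R norm (x - \<mu>)"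
    have pos: "norm (x - \<mu>) > 0" using far \<rho> by linarith
    have v: "norm v = 1" using pos by (simp add: v_def)
    have xv: "x - \<mu> = norm (x - \<mu>) *\<^sub>R v" using pos by (simp add: v_def)
    let ?C = "{j\<in>{1..k}. v \<bullet> (Z j - \<mu>) > \<rho> / 2}"
    \<comment> \<open>With \<open>n = norm (x - \<mu>)\<close>, the squared distances from
      \<open>Z j\<close> to \<open>x\<close> and to \<open>\<mu>\<close> differ by
      \<open>n * (n - 2 * (v \<bullet> (Z j - \<mu>)))\<close>, which is positive since
      \<open>n > \<rho>\<close>.\<close>
    have "norm (Z j - \<mu>) < norm (Z j - x)" if "\<not> v \<bullet> (Z j - \<mu>) > \<rho> / 2" for j
    proof -
      have "(norm (Z j - x))\<^sup>2 = (norm ((Z j - \<mu>) - (x - \<mu>)))\<^sup>2" by simp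
      also have "\<dots> = (norm (Z j - \<mu>))\<^sup>2 - 2 * ((Z j - \<mu>) \<bullet> (x - \<mu>)) + (norm (x - \<mu>))\<^sup>2"
        unfolding power2_norm_eq_inner by (simp add: inner_diff inner_commute)
      also have "(Z j - \<mu>) \<bullet> (x - \<mu>) = norm (x - \<mu>) * (v \<bullet> (Z j - \<mu>))"
        by (subst xv) (simp add: inner_commute)
      also have "(norm (Z j - \<mu>))\<^sup>2 - 2 * (norm (x - \<mu>) * (v \<bullet> (Z j - \<mu>))) + (norm (x - \<mu>))\<^sup>2
        = (norm (Z j - \<mu>))\<^sup>2 + norm (x - \<mu>) * (norm (x - \<mu>) - 2 * (v \<bullet> (Z j - \<mu>)))"
        by (simp add: power2_eq_square algebra_simps)
      also have "\<dots> > (norm (Z j - \<mu>))\<^sup>2"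
        using pos far that by (simp add: mult_pos_pos)
      finally show ?thesis by (rule power2_less_imp_less) simp
    qed
    then have "{1..k} - ?C \<subseteq> {j\<in>{1..k}. norm (Z j - \<mu>) < norm (Z j - x)}" by auto
    then have "card ({1..k} - ?C) \<le> card {j\<in>{1..k}. norm (Z j - \<mu>) < norm (Z j - x)}"
      by (rule card_mono[rotated]) simp
    moreover have "card ({1..k} - ?C) = k - card ?C"
      by (subst card_Diff_subset) auto
    moreover have "card ?C \<le> k"
      using card_mono[of "{1..k}" ?C] by (metis (lifting) card_atLeastAtMost diff_Suc_1 finite_atLeastAtMost mem_Collect_eq subsetI)
    ultimately have "real k / 2 < real (card {j\<in>{1..k}. norm (Z j - \<mu>) < norm (Z j - x)})"
      using cnt[OF v] by linarith
    then show False using that by (simp add: mem_S_set_iff)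
  qed
  show ?thesis
  proof (cases "\<mu> \<in> S_set k Z a")
    case True
    \<comment> \<open>Two disjoint sets of indices cannot both be strict majorities.\<close>
    have "a \<notin> S_set k Z \<mu>"
    proof
      assume "a \<in> S_set k Z \<mu>"
      let ?A = "{j\<in>{1..k}. norm (Z j - \<mu>) < norm (Z j - a)}" and ?B = "{j\<in>{1..k}. norm (Z j - a) < norm (Z j - \<mu>)}"
      have "card ?A + card ?B = card (?A \<union> ?B)" by (rule card_Un_disjoint[symmetric]) auto
      also have "\<dots> \<le> card {1..k}" by (rule card_mono) auto
      finally show False
        using True \<open>a \<in> S_set k Z \<mu>\<close> unfolding mem_S_set_iff by simp
    qed
    then show ?thesis using near[of a] \<rho> by linarith
  next
    case False
    \<comment> \<open>No strict inequality holds at \<open>a\<close> itself, so \<open>a\<close> and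
      \<open>\<mu>\<close> both lie in the complement and the diameter bounds their
      distance.\<close>
    have "a \<notin> S_set k Z a" by (simp add: mem_S_set_iff)
    then have "dist a \<mu> \<le> diameter (- S_set k Z a)"
      using False k by (intro diameter_bounded_bound bounded_Compl_S_set) auto
    also have "\<dots> \<le> diameter (- S_set k Z \<mu>)"
      using est by (auto simp: is_mean_estimate_def is_arg_min_def not_less)
    also have "\<dots> \<le> 2 * \<rho>"
    proof (rule diameter_le)
      fix x y assume "x \<in> - S_set k Z \<mu>" "y \<in> - S_set k Z \<mu>"
      then show "norm (x - y) \<le> 2 * \<rho>"
        using near[of x] near[of y] norm_triangle_ineq4[of "x - \<mu>" "y - \<mu>"] by simp
    qed (use \<rho> in simp)
    finally show ?thesis by (simp add: dist_norm)
  qed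
qed

section \<open>Choice of constants and the bound for the estimator\<close>

theorem theorem1:
  fixes M :: "'a measure" and D :: "(real ^ 'd) measure"
    and X :: "nat \<Rightarrow> 'a \<Rightarrow> real ^ 'd" and B :: "nat \<Rightarrow> nat set"
    and \<mu> :: "real ^ 'd" and \<Sigma> :: "real ^ 'd ^ 'd"
    and \<delta> :: real and N k :: nat and muhat :: "'a \<Rightarrow> real ^ 'd"
  assumes "prob_space M"
    and "0 < \<delta>" and "\<delta> < 1"
    and "k = nat \<lceil>360 * ln (2 / \<delta>)\<rceil>"
    and "N \<ge> 1" and "k dvd N"
    and "prob_space.indep_vars M (\<lambda>_. borel) X {1..N}"
    and "\<And>i. i \<in> {1..N} \<Longrightarrow> distr M borel (X i) = D"
    and "has_covariance D" and "\<mu> = mean D" and "\<Sigma> = covariance_matrix D"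
    and "equal_blocks N k B"
    and "\<And>\<omega>. \<omega> \<in> space M \<Longrightarrow>
           is_mean_estimate k (block_mean N k B (\<lambda>i. X i \<omega>)) (muhat \<omega>)"
  shows "with_prob_at_least M (1 - \<delta>)
           (\<lambda>\<omega>. norm (muhat \<omega> - \<mu>) \<le>
              2 * max (400 * sqrt (trace \<Sigma> / real N))
                      (240 * sqrt (max_eigenvalue \<Sigma> * ln (2 / \<delta>) / real N)))"
proof -
  interpret prob_space M by fact
  note \<delta> = assms(2,3) and indep = assms(7) and distr = assms(8) and cov = assms(9) and blocks = assms(12)
  define L where "L = ln (2 / \<delta>)"
  have "ln 2 \<le> L"
    using \<delta> unfolding L_def by (subst ln_le_cancel_iff) (auto simp: field_simps)
  then have "2/3 \<le> L" using ln2_ge_two_thirds by linarith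
  then have L: "L > 0" "1 \<le> 2 * L" by simp_all
  \<comment> \<open>Rounding up adds at most 1, which \<open>1 \<le> 2 * L\<close> absorbs. The
    upper bound on \<open>k\<close> controls the variance of a block mean.\<close>
  have kL: "360 * L \<le> real k" "real k \<le> 362 * L"
    using L unfolding assms(4) L_def by linarith+
  have k: "k \<ge> 1" "real k > 0" using kL L by auto
  define m where "m = N div k"
  have N: "N = m * k" using \<open>k dvd N\<close> by (simp add: m_def)
  have m: "m > 0" using \<open>N \<ge> 1\<close> unfolding N by (cases m) auto
  have B: "B j \<subseteq> {1..N}" "finite (B j)" "card (B j) = m" "B j \<noteq> {}" if "j \<in> {1..k}" for j
  proof -
    show sub: "B j \<subseteq> {1..N}" using blocks that unfolding equal_blocks_def by blast
    show "finite (B j)" by (rule finite_subset[OF sub]) simp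
    show card: "card (B j) = m" using blocks that unfolding equal_blocks_def m_def by blast
    show "B j \<noteq> {}" using card m by auto
  qed
  define Y where "Y j \<omega> = block_mean N k B (\<lambda>i. X i \<omega>) j - \<mu>" for j \<omega>
  have Y_eq: "Y j \<omega> = (1 / real (card (B j))) *\<^sub>R (\<Sum>i\<in>B j. X i \<omega>) - mean D" if "j \<in> {1..k}" for j \<omega>
    using B(3)[OF that] by (simp add: Y_def block_mean_def \<open>\<mu> = mean D\<close> m_def)
  \<comment> \<open>Disjoint blocks use disjoint groups of the \<open>X i\<close>, and each
    \<open>Y j\<close> is a measurable function of its group.\<close>
  have indep_Y: "indep_vars (\<lambda>_. borel) Y {1..k}"
  proof -
    have "indep_vars (\<lambda>j. PiM (B j) (\<lambda>_. borel)) (\<lambda>j \<omega>. restrict (\<lambda>i. X i \<omega>) (B j)) {1..k}"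
      using blocks B(1) by (intro indep_vars_restrict[OF indep]) (auto simp: equal_blocks_def)
    then have "indep_vars (\<lambda>_. borel)
      (\<lambda>j \<omega>. (1 / real m) *\<^sub>R (\<Sum>i\<in>B j. restrict (\<lambda>i. X i \<omega>) (B j) i) - \<mu>) {1..k}"
      by (rule indep_vars_compose2[where Y = "\<lambda>j f. (1 / real m) *\<^sub>R (\<Sum>i\<in>B j. f i) - \<mu>"]) measurable
    then show ?thesis
      by (simp add: Y_def[abs_def] block_mean_def m_def cong: sum.cong)
  qed
  have mom: "(\<integral>\<^sup>+\<omega>. ennreal ((u \<bullet> Y j \<omega>)\<^sup>2) \<partial>M) = ennreal (u \<bullet> (\<Sigma> *v u) / real m)" if j: "j \<in> {1..k}" for j u
  proof -
    have "distr M borel (X i) = D" if "i \<in> B j" for i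
      using B(1)[OF j] that by (intro distr) blast
    from block_mean_second_moment[OF B(2,4)[OF j] indep_vars_subset[OF indep B(1)[OF j]] this cov, of u]
    show ?thesis unfolding Y_eq[OF j] \<open>\<Sigma> = covariance_matrix D\<close> B(3)[OF j] .
  qed
  have psd: "0 \<le> u \<bullet> (\<Sigma> *v u)" for u
    using covariance_quadratic_form(2)[OF cov, of u] unfolding \<open>\<Sigma> = covariance_matrix D\<close>
    by (metis Bochner_Integration.integral_nonneg zero_le_power2)
  define lmax where "lmax = max_eigenvalue \<Sigma>"
  have ray: "u \<bullet> (\<Sigma> *v u) \<le> lmax * (norm u)\<^sup>2" for u
    unfolding lmax_def \<open>\<Sigma> = covariance_matrix D\<close>
    by (rule quadratic_form_le_max_eigenvalue[OF transpose_covariance_matrix])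
  \<comment> \<open>\<open>axis undefined 1\<close> is a unit vector along an arbitrary
    coordinate.\<close>
  have lmax0: "0 \<le> lmax"
    using order_trans[OF psd ray, of "axis undefined 1"] by simp
  have tr0: "0 \<le> trace \<Sigma>"
    unfolding trace_eq_sum_quadratic_form by (intro sum_nonneg psd)
  have Y_mble [measurable]: "j \<in> {1..k} \<Longrightarrow> Y j \<in> borel_measurable M" for j
    using indep_Y unfolding indep_vars_def by blast
  have V: "(\<integral>\<^sup>+\<omega>. ennreal ((u \<bullet> Y j \<omega>)\<^sup>2) \<partial>M) \<le> ennreal (lmax / real m * (norm u)\<^sup>2)" if "j \<in> {1..k}" for j u
    unfolding mom[OF that] using m ray[of u] by (intro ennreal_leI) (simp add: divide_right_mono)
  have T: "(\<integral>\<^sup>+\<omega>. ennreal ((norm (Y j \<omega>))\<^sup>2) \<partial>M) = ennreal (trace \<Sigma> / real m)" if j: "j \<in> {1..k}" for j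
  proof -
    have "ennreal ((norm y)\<^sup>2) = (\<Sum>p\<in>UNIV. ennreal ((axis p 1 \<bullet> y)\<^sup>2))" for y :: "real ^ 'd"
      by (subst sum_ennreal, simp, subst power2_norm_eq_inner, subst inner_vec_def)
        (simp add: inner_axis' power2_eq_square)
    then have "(\<integral>\<^sup>+\<omega>. ennreal ((norm (Y j \<omega>))\<^sup>2) \<partial>M) = (\<Sum>p\<in>UNIV. (\<integral>\<^sup>+\<omega>. ennreal ((axis p 1 \<bullet> Y j \<omega>)\<^sup>2) \<partial>M))"
      using j by (simp add: nn_integral_sum del: sum_ennreal)
    also have "\<dots> = ennreal (trace \<Sigma> / real m)"
      unfolding mom[OF j] trace_eq_sum_quadratic_form sum_divide_distrib using psd by (intro sum_ennreal) simp
    finally show ?thesis .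
  qed
  define \<rho> where "\<rho> = max (400 * sqrt (trace \<Sigma> / real N)) (240 * sqrt (lmax * L / real N))"
  have \<rho>0: "0 \<le> \<rho>" unfolding \<rho>_def using tr0 by (intro max.coboundedI1) simp
  have count: "\<exists>E\<in>events. prob E \<ge> 1 - \<delta> \<and>
    (\<forall>\<omega>\<in>E. \<forall>v. norm v = 1 \<longrightarrow> real (card {j\<in>{1..k}. v \<bullet> Y j \<omega> > \<rho> / 2}) < real k / 2)"
  \<comment> \<open>The count lemma requires a positive threshold. If \<open>\<rho> = 0\<close>, the
    trace vanishes and all \<open>Y j\<close> are almost surely zero, so the open half-spaces
    contain none of them.\<close>
  proof (cases "\<rho> = 0")
    case True
    have "400 * sqrt (trace \<Sigma> / real N) \<le> \<rho>" by (simp add: \<rho>_def)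
    then have "trace \<Sigma> = 0" using True tr0 \<open>N \<ge> 1\<close> by (simp add: divide_le_0_iff)
    then have "AE \<omega> in M. Y j \<omega> = 0" if "j \<in> {1..k}" for j
      using T[OF that] that by (simp add: nn_integral_0_iff_AE)
    then have "AE \<omega> in M. \<forall>j\<in>{1..k}. Y j \<omega> = 0" by (intro AE_finite_allI) auto
    then have "prob {\<omega>\<in>space M. \<forall>j\<in>{1..k}. Y j \<omega> = 0} = 1"
      by (intro prob_Collect_eq_1[THEN iffD2]) auto
    moreover have "{\<omega>\<in>space M. \<forall>j\<in>{1..k}. Y j \<omega> = 0} \<in> events" by measurable
    moreover have "real (card {j\<in>{1..k}. v \<bullet> Y j \<omega> > \<rho> / 2}) < real k / 2"
      if "\<forall>j\<in>{1..k}. Y j \<omega> = 0" for v \<omega>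
    proof -
      have none: "{j\<in>{1..k}. v \<bullet> Y j \<omega> > \<rho> / 2} = {}" using that True by auto
      show ?thesis unfolding none using k by simp
    qed
    ultimately show ?thesis using \<delta> by (intro bexI[of _ "{\<omega>\<in>space M. \<forall>j\<in>{1..k}. Y j \<omega> = 0}"]) auto
  next
    case False
    then have \<rho>: "\<rho> > 0" using \<rho>0 by simp
    define s where "s = \<rho> / 2"
    have s: "s > 0" using \<rho> by (simp add: s_def)
    have Npos: "real N > 0" using \<open>N \<ge> 1\<close> by simp
    have "(200 * sqrt (trace \<Sigma> / real N))\<^sup>2 \<le> s\<^sup>2"
      using tr0 by (intro power_mono) (auto simp: s_def \<rho>_def)
    then have s_tr: "40000 * (trace \<Sigma> / real N) \<le> s\<^sup>2"
      using tr0 by (simp add: power_mult_distrib)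
    have "(120 * sqrt (lmax * L / real N))\<^sup>2 \<le> s\<^sup>2"
      using lmax0 L by (intro power_mono) (auto simp: s_def \<rho>_def)
    then have s_l: "14400 * (lmax * L / real N) \<le> s\<^sup>2"
      using lmax0 L by (simp add: power_mult_distrib)
    have rN: "real N = real m * real k" using N by simp
    have "lmax / real m = real k * (lmax / real N)" using rN k m by (simp add: field_simps)
    also have "\<dots> \<le> 362 * L * (lmax / real N)" using kL lmax0 by (intro mult_right_mono) auto
    also have "\<dots> = 362 / 14400 * (14400 * (lmax * L / real N))" by simp
    also have "\<dots> \<le> 362 / 14400 * s\<^sup>2" by (rule mult_left_mono[OF s_l]) simp
    finally have Vs: "lmax / real m \<le> 362 / 14400 * s\<^sup>2" .
    have "8 * (trace \<Sigma> / real m) / (real k / 10) = 80 * (trace \<Sigma> / real N)" using rN k m by (simp add: field_simps)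
    also have "\<dots> \<le> 1 / 500 * s\<^sup>2" using s_tr by simp
    finally have "2 * (lmax / real m + 8 * (trace \<Sigma> / real m) / (real k / 10)) \<le> 2 * (362 / 14400 * s\<^sup>2 + 1 / 500 * s\<^sup>2)"
      using Vs by simp
    \<comment> \<open>Numerically, \<open>2 * (362 / 14400 + 1 / 500)\<close> is about 0.0543, below
      \<open>3 / 50\<close>.\<close>
    then have "2 * (lmax / real m + 8 * (trace \<Sigma> / real m) / (real k / 10)) \<le> 3 / 50 * s\<^sup>2"
      using zero_le_power2[of s] by argo
    moreover define q where "q = 2 * (lmax / real m + 8 * (trace \<Sigma> / real m) / (real k / 10)) / s\<^sup>2"
    ultimately have "q \<le> 3 / 50"
      using s by (simp add: divide_le_eq)
    then have kq: "2 * real k * q \<le> 2 * real k * (3 / 50)" by (rule mult_left_mono) simp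
    have l: "ln (1 / \<delta>) \<le> real k / 360"
    proof -
      have "ln (1 / \<delta>) \<le> L" using \<delta> by (simp add: L_def divide_right_mono)
      then show ?thesis using kL by simp
    qed
    obtain E where E: "E \<in> events" "prob E \<ge> 1 - \<delta>"
      and cnt: "\<And>\<omega> v. \<omega> \<in> E \<Longrightarrow> norm v = 1 \<Longrightarrow> real (card {j\<in>{1..k}. v \<bullet> Y j \<omega> > s}) \<le>
        2 * (ln (1 / \<delta>) + real k / 10 / 2 + 2 * real (card {1..k}) * (2 * (lmax / real m + 8 * (trace \<Sigma> / real m) / (real k / 10)) / s\<^sup>2))"
      using uniform_halfspace_count[OF finite_atLeastAtMost indep_Y, of \<delta> s "real k / 10" "lmax / real m" "trace \<Sigma> / real m"]
        V T s k lmax0 tr0 \<delta> by auto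
    have "real (card {j\<in>{1..k}. v \<bullet> Y j \<omega> > \<rho> / 2}) < real k / 2" if "\<omega> \<in> E" "norm v = 1" for \<omega> v
    proof -
      \<comment> \<open>The three contributions sum to
        \<open>2 * (1 / 360 + 1 / 20 + 3 / 25)\<close>, about 0.346 times \<open>x\<close>, which
        leaves room below \<open>x / 2\<close>.\<close>
      have num: "2 * (a + x / 10 / 2 + b) < x / 2"
        if "a \<le> x / 360" "b \<le> 2 * x * (3 / 50)" "x > 0" for a b x :: real
        using that by simp
      have "real (card {j\<in>{1..k}. v \<bullet> Y j \<omega> > s}) \<le> 2 * (ln (1 / \<delta>) + real k / 10 / 2 + 2 * real k * q)"
        using cnt[OF that] unfolding q_def by simp
      also note num[OF l kq k(2)]
      finally show ?thesis unfolding s_def .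
    qed
    then show ?thesis using E by blast
  qed
  then obtain E where E: "E \<in> events" "prob E \<ge> 1 - \<delta>"
    and cnt: "\<And>\<omega> v. \<omega> \<in> E \<Longrightarrow> norm v = 1 \<Longrightarrow> real (card {j\<in>{1..k}. v \<bullet> Y j \<omega> > \<rho> / 2}) < real k / 2"
    by blast
  have "norm (muhat \<omega> - \<mu>) \<le> 2 * \<rho>" if "\<omega> \<in> E" for \<omega>
  proof (rule mean_estimate_close[OF _ k(1) \<rho>0])
    show "is_mean_estimate k (block_mean N k B (\<lambda>i. X i \<omega>)) (muhat \<omega>)"
      using assms(13) sets.sets_into_space[OF E(1)] that by blast
  qed (use cnt[OF that] in \<open>simp add: Y_def\<close>)
  then show ?thesis
    unfolding with_prob_at_least_def \<rho>_def lmax_def L_def using E by blast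
qed

end
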